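(* Let $s\ge 3$. Then $$m_2(s)\le \max\left\{\min_{i\in\{1,2\}}\prod_{j=0}^{s-3}\left\lceil\frac{(n_i-2)-j}{s-2}\right\rceil\right\},$$ where the maximum is taken over all pairs $n_1,n_2\in\mathbb{N}$ satisfying: (1) $n_1,n_2\ge s$; (2) $n_1+n_2\le R_2(s)+2$; (3) $|n_1-n_2|<R(s-1,s)-(s-2)$.
   Context: $R(a,b)$ denotes the two-color Ramsey number: the least $n$ such that every coloring of the edges of the complete graph $K_n$ with colors $1,2$ contains a $K_a$ all of whose edges have color $1$ or a $K_b$ all of whose edges have color $2$; $R_2(s)=R(s,s)$. The critical multiplicity $m_2(s)=m(s,s)$ is the smallest number of monochromatic subgraphs isomorphic to $K_s$ (in either color) that occur in a 2-coloring of the edges of $K_{R(s,s)}$, i.e. the largest $M$ such that every 2-coloring of the edges of $K_{R(s,s)}$ contains at least $M$ monochromatic copies of $K_s$. *)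

theory Defs
  imports Complex_Main "HOL-Library.Ramsey"
begin

text \<open>
  A 2-colouring of the edges of the complete graph on the vertex set \<open>{..<n}\<close> is a map in
  \<open>nsets {..<n} 2 \<rightarrow> {..<2}\<close>; the library counts colours from 0, so the usual colours 1 and 2
  are 0 and 1 here. \<open>partn_lst {..<n} [a, b] 2\<close> says that every such colouring has an
  \<open>a\<close>-clique in the first colour or a \<open>b\<close>-clique in the second.
\<close>

definition ramsey_number :: "nat \<Rightarrow> nat \<Rightarrow> nat" where
  "ramsey_number a b = (LEAST n. partn_lst {..<n} [a, b] 2)"

text \<open>By Ramsey's theorem the minimum is taken over a nonempty set.\<close>

lemma partn_lst_ramsey_number: "partn_lst {..<ramsey_number a b} [a, b] 2"
proof -
  have "\<exists>n. partn_lst {..<n::nat} [a, b] 2"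
    using ramsey2_full by blast
  then show ?thesis
    unfolding ramsey_number_def by (rule LeastI_ex)
qed

abbreviation ramsey_number2 :: "nat \<Rightarrow> nat" where
  "ramsey_number2 s \<equiv> ramsey_number s s"

text \<open>A copy of \<open>K\<^sub>s\<close> in a complete graph is identified with its set of \<open>s\<close> vertices.\<close>

definition mono_cliques :: "nat \<Rightarrow> nat \<Rightarrow> (nat set \<Rightarrow> nat) \<Rightarrow> nat set set" where
  "mono_cliques n s f = {H \<in> nsets {..<n} s. \<exists>i<2. f ` nsets H 2 \<subseteq> {i}}"

definition critical_multiplicity2 :: "nat \<Rightarrow> nat" where
  "critical_multiplicity2 s =
    (INF f \<in> nsets {..<ramsey_number2 s} 2 \<rightarrow> {..<2}. card (mono_cliques (ramsey_number2 s) s f))"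

end

theory Submission
  imports Defs
begin

text \<open>
  Take a colouring of the complete graph on \<open>R(s,s) - 1\<close> vertices without monochromatic \<open>K\<^sub>s\<close> and
  duplicate a vertex \<open>v\<close>, giving the edge between the twins colour \<open>i\<close>. The monochromatic copies of
  \<open>K\<^sub>s\<close> then correspond to copies of \<open>K\<^bsub>s-2\<^esub>\<close> in the colour-\<open>i\<close> neighbourhood of \<open>v\<close>, which has no
  \<open>K\<^bsub>s-1\<^esub>\<close> of that colour, so Zykov's theorem bounds their number by the product of the part sizes of
  the balanced complete \<open>(s-2)\<close>-partite graph. With \<open>n\<^sub>i - 2\<close> the size of the neighbourhood, the
  constraints on \<open>n\<^sub>1, n\<^sub>2\<close> follow from \<open>n\<^sub>i - 2 < R(s-1,s)\<close> and
  \<open>R(s-1,s) + s - 1 \<le> R(s,s)\<close>.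
\<close>

section \<open>Monochromatic cliques and colour neighbourhoods\<close>

definition unicolour :: "('a set \<Rightarrow> nat) \<Rightarrow> nat \<Rightarrow> 'a set \<Rightarrow> bool" where
  "unicolour f i H \<longleftrightarrow> (\<forall>x\<in>H. \<forall>y\<in>H. x \<noteq> y \<longrightarrow> f {x, y} = i)"

definition cliques :: "('a set \<Rightarrow> nat) \<Rightarrow> nat \<Rightarrow> 'a set \<Rightarrow> nat \<Rightarrow> 'a set set" where
  "cliques f i A k = {H \<in> nsets A k. unicolour f i H}"

definition neighbours :: "('a set \<Rightarrow> nat) \<Rightarrow> nat \<Rightarrow> 'a set \<Rightarrow> 'a \<Rightarrow> 'a set" where
  "neighbours f i A v = {u \<in> A. u \<noteq> v \<and> f {v, u} = i}"

text \<open>A witness for \<open>card A < R(a, b)\<close>. The vertex set is arbitrary, so that the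
  notion passes to neighbourhoods.\<close>

definition avoids :: "('a set \<Rightarrow> nat) \<Rightarrow> 'a set \<Rightarrow> nat \<Rightarrow> nat \<Rightarrow> bool" where
  "avoids f A a b \<longleftrightarrow> f \<in> nsets A 2 \<rightarrow> {..<2} \<and> cliques f 0 A a = {} \<and> cliques f 1 A b = {}"

lemma image_nsets_2_subset_iff: "f ` nsets H 2 \<subseteq> {i} \<longleftrightarrow> unicolour f i H"
  by (auto simp: unicolour_def nsets_2_eq)

lemma unicolour_subset: "unicolour f i H \<Longrightarrow> K \<subseteq> H \<Longrightarrow> unicolour f i K"
  unfolding unicolour_def by blast

lemma unicolour_insert:
  assumes "unicolour f i K" "\<And>u. u \<in> K \<Longrightarrow> u \<noteq> v \<Longrightarrow> f {v, u} = i"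
  shows "unicolour f i (insert v K)"
  using assms unfolding unicolour_def by (auto simp: insert_commute)

lemma finite_cliques: "finite A \<Longrightarrow> finite (cliques f i A k)"
  unfolding cliques_def by (simp add: finite_imp_finite_nsets)

lemma cliques_mono: "A \<subseteq> B \<Longrightarrow> cliques f i A k \<subseteq> cliques f i B k"
  unfolding cliques_def using nsets_mono by blast

lemma clique_insert:
  assumes "K \<in> cliques f i (neighbours f i A v) k" "v \<in> A"
  shows "insert v K \<in> cliques f i A (Suc k)"
proof -
  have "K \<subseteq> A" "v \<notin> K" "finite K" "card K = k"
    using assms by (auto simp: cliques_def nsets_def neighbours_def)
  moreover have "unicolour f i (insert v K)"
    using assms by (intro unicolour_insert) (auto simp: cliques_def nsets_def neighbours_def)
  ultimately show ?thesis
    using assms(2) by (auto simp: cliques_def nsets_def)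
qed

lemma clique_remove:
  assumes "H \<in> cliques f i A (Suc k)" "v \<in> H"
  shows "H - {v} \<in> cliques f i (neighbours f i A v) k"
  using assms by (auto simp: cliques_def nsets_def neighbours_def unicolour_def)

lemma neighbours_clique_free:
  assumes "cliques f i A (Suc k) = {}" "v \<in> A"
  shows "cliques f i (neighbours f i A v) k = {}"
  using clique_insert[OF _ assms(2)] assms(1) by blast

section \<open>Zykov's clique count and balanced products\<close>

lemma card_cliques_containing:
  assumes "finite A"
  shows "card {H \<in> cliques f i A (Suc k). v \<in> H} \<le> card (cliques f i (neighbours f i A v) k)"
proof (rule card_inj_on_le)
  show "inj_on (\<lambda>H. H - {v}) {H \<in> cliques f i A (Suc k). v \<in> H}"
    by (auto simp: inj_on_def)
  show "(\<lambda>H. H - {v}) ` {H \<in> cliques f i A (Suc k). v \<in> H} \<subseteq> cliques f i (neighbours f i A v) k"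
    by (auto intro!: clique_remove)
  show "finite (cliques f i (neighbours f i A v) k)"
    using assms by (intro finite_cliques) (simp add: neighbours_def)
qed

text \<open>
  Zykov's argument: let \<open>v\<close> lie in the largest number of \<open>(r+1)\<close>-cliques. Its neighbourhood contains
  none of them, so each meets the complement \<open>B\<close> of the neighbourhood, and every vertex of \<open>B\<close> lies
  in at most as many as \<open>v\<close> does.
\<close>

lemma card_cliques_le_prod_list:
  assumes "finite A" "cliques f i A (Suc r) = {}"
  shows "\<exists>xs. length xs = r \<and> sum_list xs = card A \<and> card (cliques f i A r) \<le> prod_list xs"
  using assms
proof (induction r arbitrary: A)
  case 0
  have "A = {}"
  proof (rule ccontr)
    assume "A \<noteq> {}"
    then obtain x where "x \<in> A" by blast
    then have "{x} \<in> cliques f i A (Suc 0)"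
      by (simp add: cliques_def nsets_def unicolour_def)
    with 0 show False by blast
  qed
  moreover have "cliques f i {} 0 = {{}}"
    by (auto simp: cliques_def unicolour_def)
  ultimately show ?case by simp
next
  case (Suc r)
  show ?case
  proof (cases "A = {}")
    case True
    then have "cliques f i A (Suc r) = {}"
      by (simp add: cliques_def nsets_empty_iff)
    with True show ?thesis
      by (intro exI[of _ "replicate (Suc r) 0"]) (simp add: sum_list_replicate)
  next
    case False
    define D where "D v = card {H \<in> cliques f i A (Suc r). v \<in> H}" for v
    obtain v where v: "v \<in> A" and max: "\<And>u. u \<in> A \<Longrightarrow> D u \<le> D v"
      using Max_in[of "D ` A"] Max_ge[of "D ` A"] Suc.prems(1) False
      by (metis (no_types, opaque_lifting) finite_imageI image_iff image_is_empty)
    define N where "N = neighbours f i A v"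
    have N: "N \<subseteq> A" "finite N"
      using Suc.prems(1) by (auto simp: N_def neighbours_def)
    have free: "cliques f i N (Suc r) = {}"
      unfolding N_def using Suc.prems(2) v by (rule neighbours_clique_free)
    obtain xs where xs: "length xs = r" "sum_list xs = card N" "card (cliques f i N r) \<le> prod_list xs"
      using Suc.IH[OF N(2) free] by blast
    have "cliques f i A (Suc r) \<subseteq> (\<Union>u\<in>A - N. {H \<in> cliques f i A (Suc r). u \<in> H})"
    proof
      fix H assume H: "H \<in> cliques f i A (Suc r)"
      have "\<not> H \<subseteq> N"
        using H free by (auto simp: cliques_def nsets_def)
      moreover have "H \<subseteq> A" using H by (auto simp: cliques_def nsets_def)
      ultimately show "H \<in> (\<Union>u\<in>A - N. {H \<in> cliques f i A (Suc r). u \<in> H})"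
        using H by blast
    qed
    then have "card (cliques f i A (Suc r)) \<le> card (\<Union>u\<in>A - N. {H \<in> cliques f i A (Suc r). u \<in> H})"
      using Suc.prems(1) by (intro card_mono) (auto simp: finite_cliques)
    also have "\<dots> \<le> (\<Sum>u\<in>A - N. D u)"
      unfolding D_def using Suc.prems(1) by (intro card_UN_le) simp
    also have "\<dots> \<le> card (A - N) * D v"
      using max sum_bounded_above[of "A - N" D "D v"] by simp
    also have "\<dots> \<le> card (A - N) * prod_list xs"
      using card_cliques_containing[OF Suc.prems(1), of f i r v] xs(3)
      by (intro mult_left_mono) (auto simp: D_def N_def)
    \<comment> \<open>The complement of the neighbourhood becomes one more part.\<close>
    finally show ?thesis
      using xs N Suc.prems(1)
      by (intro exI[of _ "card (A - N) # xs"]) (simp add: card_Diff_subset card_mono)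
  qed
qed

text \<open>
  This is \<open>a \<le> q ((q + 1) / q)\<^bsup>a - q\<^esup>\<close> cleared of denominators and negative exponents. Multiplied
  over all factors of a product with fixed sum, it yields the balanced bound.
\<close>

lemma bernoulli_tangent:
  fixes a q :: nat
  assumes "q \<ge> 1"
  shows "a * q ^ a * (q + 1) ^ q \<le> q * q ^ q * (q + 1) ^ a"
proof (cases "a \<le> q")
  case True
  \<comment> \<open>With \<open>u = q - a\<close> this is the claim after cancelling common powers.
    The induction rests on \<open>(q - u - 1) * (q + 1) \<le> (q - u) * q\<close>.\<close>
  have *: "(q - u) * (q + 1) ^ u \<le> q * q ^ u" if "u \<le> q" for u
    using that
  proof (induction u)
    case (Suc u)
    have "(q - Suc u) * (q + 1) \<le> (q - u) * q"
      using Suc.prems by (auto simp: algebra_simps diff_mult_distrib)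
    then have "(q - Suc u) * (q + 1) ^ Suc u \<le> (q - u) * q * (q + 1) ^ u"
      by (metis mult.assoc mult_le_mono1 power_Suc)
    also have "\<dots> = ((q - u) * (q + 1) ^ u) * q" by (simp only: ac_simps)
    also have "\<dots> \<le> (q * q ^ u) * q"
      using Suc by (intro mult_le_mono1) simp
    finally show ?case by (simp add: ac_simps)
  qed simp
  have e: "q = a + (q - a)" using True by simp
  have "a * (q + 1) ^ (q - a) \<le> q * q ^ (q - a)"
    using *[of "q - a"] True by simp
  then have "(a * (q + 1) ^ (q - a)) * (q ^ a * (q + 1) ^ a) \<le> (q * q ^ (q - a)) * (q ^ a * (q + 1) ^ a)"
    by (rule mult_le_mono1)
  moreover have "(q + 1) ^ q = (q + 1) ^ a * (q + 1) ^ (q - a)" "q ^ q = q ^ a * q ^ (q - a)"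
    using e by (metis power_add)+
  ultimately show ?thesis by (simp only: ac_simps)
next
  case False
  define t where "t = a - q"
  have a: "a = q + t" using False by (simp add: t_def)
  have *: "(q + t) * q ^ t \<le> q * (q + 1) ^ t" for t
  proof (induction t)
    case (Suc t)
    have "(q + Suc t) * q ^ Suc t \<le> ((q + t) * q ^ t) * (q + 1)"
    proof -
      have "(q + Suc t) * q \<le> (q + t) * (q + 1)"
        by (simp add: algebra_simps)
      then have "((q + Suc t) * q) * q ^ t \<le> ((q + t) * (q + 1)) * q ^ t"
        by (rule mult_le_mono1)
      then show ?thesis by (simp only: ac_simps power_Suc)
    qed
    also have "\<dots> \<le> (q * (q + 1) ^ t) * (q + 1)"
      using Suc by (rule mult_le_mono1)
    finally show ?case by (simp only: ac_simps power_Suc)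
  qed simp
  have "((q + t) * q ^ t) * (q ^ q * (q + 1) ^ q) \<le> (q * (q + 1) ^ t) * (q ^ q * (q + 1) ^ q)"
    using * by (rule mult_le_mono1)
  then show ?thesis by (simp only: a power_add ac_simps)
qed

text \<open>The tangent inequality is an equality at \<open>a = q\<close> and
  \<open>a = q + 1\<close>. Its product over the list involves only length and sum, so cancelling
  leaves the value for \<open>m\<close> entries \<open>q + 1\<close> and \<open>r - m\<close>
  entries \<open>q\<close>.\<close>

lemma prod_list_le_balanced:
  fixes xs :: "nat list"
  assumes "length xs = r" "sum_list xs = q * r + m" "m < r" "q \<ge> 1"
  shows "prod_list xs \<le> (q + 1) ^ m * q ^ (r - m)"
proof -
  \<comment> \<open>Stated for all lists, since the fixed length and sum do not pass to
    tails.\<close>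
  have *: "prod_list xs * q ^ sum_list xs * (q + 1) ^ (q * length xs)
      \<le> q ^ length xs * q ^ (q * length xs) * (q + 1) ^ sum_list xs" for xs :: "nat list"
  proof (induction xs)
    case (Cons a xs)
    have "(a * q ^ a * (q + 1) ^ q) * (prod_list xs * q ^ sum_list xs * (q + 1) ^ (q * length xs))
      \<le> (q * q ^ q * (q + 1) ^ a) * (q ^ length xs * q ^ (q * length xs) * (q + 1) ^ sum_list xs)"
      using bernoulli_tangent[OF assms(4)] Cons by (rule mult_le_mono)
    then show ?case
      by (simp add: power_add ac_simps)
  qed simp
  have r: "q ^ r = q ^ m * q ^ (r - m)"
    using assms(3) by (metis le_add_diff_inverse less_imp_le power_add)
  have "prod_list xs * (q ^ m * (q ^ (q * r) * (q + 1) ^ (q * r)))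
      \<le> ((q + 1) ^ m * q ^ (r - m)) * (q ^ m * (q ^ (q * r) * (q + 1) ^ (q * r)))"
    using *[of xs] unfolding assms(1,2) power_add r by (simp only: ac_simps)
  moreover have "q ^ m * (q ^ (q * r) * (q + 1) ^ (q * r)) > 0"
    using assms(4) by simp
  ultimately show ?thesis
    by (metis mult_le_cancel2)
qed

text \<open>The quotient is \<open>q + (m - j) / r\<close>, whose last term lies in (0, 1) for
  \<open>j < m\<close> and in (-1, 0] for \<open>m \<le> j < r\<close>. The ceilings are thus the
  balanced part sizes.\<close>

lemma prod_ceiling_balanced:
  assumes "m < r"
  shows "(\<Prod>j<r. \<lceil>(real (q * r + m) - real j) / real r\<rceil>) = int ((q + 1) ^ m * q ^ (r - m))"
proof -
  have c: "\<lceil>(real (q * r + m) - real j) / real r\<rceil> = (if j < m then int q + 1 else int q)"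
    if "j < r" for j
    using assms that by (auto simp: ceiling_eq_iff field_simps)
  have "(\<Prod>j<r. \<lceil>(real (q * r + m) - real j) / real r\<rceil>) = (\<Prod>j<r. if j < m then int q + 1 else int q)"
    using c by (intro prod.cong) auto
  also have "\<dots> = (\<Prod>j\<in>{..<r} \<inter> {j. j < m}. int q + 1) * (\<Prod>j\<in>{..<r} \<inter> - {j. j < m}. int q)"
    by (subst prod.If_cases) simp_all
  also have "{..<r} \<inter> {j. j < m} = {..<m}" using assms by auto
  also have "{..<r} \<inter> - {j. j < m} = {m..<r}" by auto
  finally show ?thesis by (simp add: add.commute)
qed

lemma card_cliques_le_prod_ceiling:
  assumes "finite A" "cliques f i A (Suc r) = {}" "r \<ge> 1" "card A \<ge> r"
  shows "int (card (cliques f i A r)) \<le> (\<Prod>j<r. \<lceil>(real (card A) - real j) / real r\<rceil>)"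
proof -
  define q m where "q = card A div r" and "m = card A mod r"
  have d: "card A = q * r + m" "m < r"
    using assms(3) by (auto simp: q_def m_def)
  have "q \<ge> 1" using assms(3,4) by (simp add: q_def Suc_le_eq div_greater_zero_iff)
  obtain xs where xs: "length xs = r" "sum_list xs = card A" "card (cliques f i A r) \<le> prod_list xs"
    using card_cliques_le_prod_list[OF assms(1,2)] by blast
  have "prod_list xs \<le> (q + 1) ^ m * q ^ (r - m)"
    using prod_list_le_balanced xs d \<open>q \<ge> 1\<close> by simp
  then show ?thesis
    unfolding d(1) prod_ceiling_balanced[OF d(2)] using xs(3) by linarith
qed

section \<open>Ramsey numbers through avoiding colourings\<close>

lemma partn_lst_iff_not_avoids:
  "partn_lst A [a, b] 2 \<longleftrightarrow> (\<nexists>f. avoids f A a b)"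
proof -
  have "(\<exists>i<length [a, b]. Q i) \<longleftrightarrow> Q 0 \<or> Q 1" for Q
    by (auto simp: less_Suc_eq)
  then show ?thesis
    unfolding partn_lst_def monochromatic_def image_nsets_2_subset_iff avoids_def cliques_def
    by (simp add: numeral_2_eq_2) blast
qed

lemma less_ramsey_number_avoids:
  assumes "n < ramsey_number a b"
  obtains f where "avoids f {..<n} a b"
proof -
  have "\<not> partn_lst {..<n} [a, b] 2"
    using assms unfolding ramsey_number_def by (rule not_less_Least)
  with that show thesis by (auto simp: partn_lst_iff_not_avoids)
qed

lemma avoids_subset:
  assumes "avoids f B a b" "A \<subseteq> B"
  shows "avoids f A a b"
  using assms(1) cliques_mono[OF assms(2), of f 0 a] cliques_mono[OF assms(2), of f 1 b]
    subsetD[OF nsets_Pi_contra[OF assms(2)], of f 2 "\<lambda>_. {..<2}"]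
  by (simp add: avoids_def)

lemma clique_vimage:
  assumes "inj_on h A" "H \<in> cliques (\<lambda>e. f (h ` e)) i A k"
  shows "h ` H \<in> cliques f i (h ` A) k"
proof -
  have "inj_on h H"
    using assms inj_on_subset by (auto simp: cliques_def nsets_def)
  then show ?thesis
    using assms(2) by (auto simp: cliques_def nsets_def unicolour_def card_image)
qed

lemma avoids_vimage:
  assumes "avoids f (h ` A) a b" "inj_on h A"
  shows "avoids (\<lambda>e. f (h ` e)) A a b"
proof -
  have "(\<lambda>e. f (h ` e)) \<in> nsets A 2 \<rightarrow> {..<2}"
    using nsets_compose_image_funcset[of f "h ` A" 2 "{..<2}" h A] assms
    by (auto simp: avoids_def comp_def)
  then show ?thesis
    using assms(1) clique_vimage[OF assms(2), of _ f 0 a] clique_vimage[OF assms(2), of _ f 1 b]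
    by (auto simp: avoids_def)
qed

text \<open>Otherwise \<open>ramsey_number a b\<close> of the vertices, relabelled as an initial
  segment of the naturals, would carry an avoiding colouring.\<close>

lemma avoids_card_less:
  assumes "avoids f A a b" "finite A"
  shows "card A < ramsey_number a b"
proof (rule ccontr)
  assume "\<not> ?thesis"
  then obtain B where B: "B \<subseteq> A" "card B = ramsey_number a b"
    by (meson not_less obtain_subset_with_card_n)
  then obtain h where h: "bij_betw h {..<ramsey_number a b} B"
    using assms(2) by (metis ex_bij_betw_nat_finite finite_subset atLeast0LessThan)
  have "avoids f (h ` {..<ramsey_number a b}) a b"
    using avoids_subset[OF assms(1) B(1)] h by (simp add: bij_betw_def)
  then have "avoids (\<lambda>e. f (h ` e)) {..<ramsey_number a b} a b"
    using h by (intro avoids_vimage) (simp_all add: bij_betw_def)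
  then show False
    using partn_lst_ramsey_number partn_lst_iff_not_avoids by blast
qed

lemma avoids_swap:
  assumes "avoids f A a b"
  shows "avoids (\<lambda>e. 1 - f e) A b a"
proof -
  \<comment> \<open>With values below 2, truncated subtraction from 1 really exchanges the
    colours.\<close>
  have 2: "f {x, y} < 2" if "x \<in> A" "y \<in> A" "x \<noteq> y" for x y
    using assms that by (auto simp: avoids_def Pi_iff)
  have "unicolour f (1 - i) H" if "unicolour (\<lambda>e. 1 - f e) i H" "H \<subseteq> A" for H i
    unfolding unicolour_def
  proof (intro ballI impI)
    fix x y assume xy: "x \<in> H" "y \<in> H" "x \<noteq> y"
    then have "1 - f {x, y} = i" using that(1) by (simp add: unicolour_def)
    moreover have "f {x, y} < 2" using 2 xy that(2) by blast
    ultimately show "f {x, y} = 1 - i" by linarith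
  qed
  then have "cliques (\<lambda>e. 1 - f e) i A k \<subseteq> cliques f (1 - i) A k" for i k
    by (auto simp: cliques_def nsets_def)
  from this[of 0 b] this[of 1 a] show ?thesis
    using assms by (auto simp: avoids_def)
qed

text \<open>If \<open>R(b, a) < R(a, b)\<close>, swapping the colours of an avoiding colouring on
  \<open>R(b, a)\<close> vertices gives \<open>R(b, a) < R(b, a)\<close>.\<close>

lemma ramsey_number_commute: "ramsey_number a b = ramsey_number b a"
proof -
  have "\<not> ramsey_number b a < ramsey_number a b" for a b
    using less_ramsey_number_avoids avoids_swap avoids_card_less
    by (metis card_lessThan finite_lessThan less_irrefl)
  then show ?thesis by (metis linorder_neqE_nat)
qed

lemma ramsey_number_pos:
  assumes "a \<ge> 1" "b \<ge> 1"
  shows "ramsey_number a b \<ge> 1"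
proof -
  have "avoids (\<lambda>_. 0) ({} :: nat set) a b"
    using assms by (auto simp: avoids_def cliques_def nsets_empty_iff)
  from avoids_card_less[OF this] show ?thesis by simp
qed

text \<open>
  To an extremal colouring for \<open>(a, b)\<close> one adds \<open>b - 1\<close> vertices, joined to each other in
  colour 1 and to all old vertices in colour 0.
\<close>

lemma ramsey_number_Suc_ge:
  assumes "a \<ge> 1" "b \<ge> 1"
  shows "ramsey_number a b + b - 1 \<le> ramsey_number (Suc a) b"
proof -
  define M where "M = ramsey_number a b - 1"
  have M: "ramsey_number a b = Suc M"
    using ramsey_number_pos[OF assms] by (simp add: M_def)
  then obtain f where f: "avoids f {..<M} a b"
    using less_ramsey_number_avoids by (metis lessI)
  define g where "g e = (if e \<subseteq> {..<M} then f e else if e \<subseteq> {M..} then 1 else 0)" for e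
  have old: "unicolour f i H" if "unicolour g i H" "H \<subseteq> {..<M}" for i H
    using that by (auto simp: unicolour_def g_def subset_iff)
  have "avoids g {..<M + (b - 1)} (Suc a) b"
    unfolding avoids_def
  proof (intro conjI)
    show "g \<in> nsets {..<M + (b - 1)} 2 \<rightarrow> {..<2}"
      using f by (auto simp: g_def avoids_def Pi_iff nsets_def)
    show "cliques g 0 {..<M + (b - 1)} (Suc a) = {}"
    proof (rule ccontr)
      assume "\<not> ?thesis"
      then obtain H where H: "finite H" "card H = Suc a" "unicolour g 0 H"
        by (auto simp: cliques_def nsets_def)
      \<comment> \<open>New vertices are joined in colour 1, so a colour-0 clique contains at most
        one and keeps \<open>a\<close> old ones.\<close>
      have "card (H \<inter> {M..}) \<le> 1"
      proof -
        have "x = y" if "x \<in> H \<inter> {M..}" "y \<in> H \<inter> {M..}" for x y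
          using that H(3) by (force simp: unicolour_def g_def)
        then show ?thesis using H(1) by (metis card_le_Suc0_iff_eq One_nat_def finite_Int)
      qed
      moreover have "card H = card (H \<inter> {..<M}) + card (H \<inter> {M..})"
        using H(1) by (subst card_Un_disjoint[symmetric]) (auto intro: arg_cong[of _ _ card])
      ultimately have "a \<le> card (H \<inter> {..<M})" using H(2) by simp
      then obtain K where K: "K \<subseteq> H \<inter> {..<M}" "card K = a"
        by (meson obtain_subset_with_card_n)
      then have "K \<in> cliques f 0 {..<M} a"
        using old[of 0 K] unicolour_subset[OF H(3)] H(1)
        by (auto simp: cliques_def nsets_def finite_subset)
      with f show False by (auto simp: avoids_def)
    qed
    show "cliques g 1 {..<M + (b - 1)} b = {}"
    proof (rule ccontr)
      assume "\<not> ?thesis"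
      then obtain H where H: "finite H" "card H = b" "unicolour g 1 H" "H \<subseteq> {..<M + (b - 1)}"
        by (auto simp: cliques_def nsets_def)
      \<comment> \<open>No colour-1 clique crosses between old and new vertices, and there are only
        \<open>b - 1\<close> new ones.\<close>
      consider "H \<subseteq> {..<M}" | "H \<subseteq> {M..}" | x y where "x \<in> H" "y \<in> H" "x < M" "M \<le> y"
        by (meson atLeast_iff lessThan_iff not_less subsetI)
      then show False
      proof cases
        case 1
        then have "H \<in> cliques f 1 {..<M} b"
          using H old[of 1 H] by (auto simp: cliques_def nsets_def)
        with f show False by (auto simp: avoids_def)
      next
        case 2
        then have "H \<subseteq> {M..<M + (b - 1)}" using H(4) by auto
        then have "card H \<le> b - 1"
          using card_mono[of "{M..<M + (b - 1)}" H] by simp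
        with H(2) assms(2) show False by simp
      next
        case 3
        then have "g {x, y} = 0" by (auto simp: g_def)
        moreover have "g {x, y} = 1" using 3 H(3) by (auto simp: unicolour_def)
        ultimately show False by simp
      qed
    qed
  qed
  from avoids_card_less[OF this] show ?thesis using M by simp
qed

section \<open>Neighbourhoods in an extremal colouring and vertex duplication\<close>

text \<open>An \<open>(s-1)\<close>-clique of colour \<open>i\<close> in the neighbourhood would
  extend by \<open>v\<close> to an \<open>s\<close>-clique. For colour 1 the symmetry of the Ramsey
  number is used.\<close>

lemma card_neighbours_less:
  assumes "avoids f A s s" "finite A" "v \<in> A" "i < 2" "s \<ge> 1"
  shows "card (neighbours f i A v) < ramsey_number (s - 1) s"
proof -
  let ?N = "neighbours f i A v"
  have N: "?N \<subseteq> A" "finite ?N" using assms(2) by (auto simp: neighbours_def)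
  note sub = avoids_subset[OF assms(1) N(1)]
  have "cliques f i A (Suc (s - 1)) = {}"
    using assms by (auto simp: avoids_def less_2_cases_iff)
  then have free: "cliques f i ?N (s - 1) = {}"
    using assms(3) by (rule neighbours_clique_free)
  consider "i = 0" | "i = 1" using assms(4) by linarith
  then show ?thesis
  proof cases
    case 1
    then have "avoids f ?N (s - 1) s" using sub free by (simp add: avoids_def)
    then show ?thesis using avoids_card_less N(2) by blast
  next
    case 2
    then have "avoids f ?N s (s - 1)" using sub free by (simp add: avoids_def)
    then show ?thesis using avoids_card_less N(2) ramsey_number_commute by metis
  qed
qed

lemma card_neighbours_add:
  assumes "avoids f A a b" "finite A" "v \<in> A"
  shows "card (neighbours f 0 A v) + card (neighbours f 1 A v) = card A - 1"
proof -
  have "f {v, u} = 0 \<or> f {v, u} = 1" if "u \<in> A" "u \<noteq> v" for u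
    using assms that by (auto simp: avoids_def Pi_iff less_2_cases_iff)
  then have "A - {v} = neighbours f 0 A v \<union> neighbours f 1 A v"
    by (auto simp: neighbours_def)
  moreover have "neighbours f 0 A v \<inter> neighbours f 1 A v = {}"
    by (auto simp: neighbours_def)
  ultimately show ?thesis
    using assms(2,3) by (metis card_Diff_singleton card_Un_disjoint finite_Diff finite_Un)
qed

lemma critical_multiplicity2_le:
  assumes "f \<in> nsets {..<ramsey_number2 s} 2 \<rightarrow> {..<2}"
  shows "critical_multiplicity2 s \<le> card (mono_cliques (ramsey_number2 s) s f)"
  unfolding critical_multiplicity2_def by (rule cINF_lower[OF _ assms]) simp

text \<open>
  Duplicate a vertex \<open>v\<close> of an extremal colouring and give the edge between \<open>v\<close> and its twin the
  colour \<open>c\<close>: a monochromatic clique must use this edge, and its other vertices form a clique in the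
  \<open>c\<close>-neighbourhood of \<open>v\<close>.
\<close>

lemma critical_multiplicity2_le_cliques:
  assumes f: "avoids f {..<M} s s" and R: "ramsey_number2 s = Suc M"
    and v: "v < M" and c: "c < 2"
  shows "critical_multiplicity2 s \<le> card (cliques f c (neighbours f c {..<M} v) (s - 2))"
proof -
  \<comment> \<open>The twin is the new vertex \<open>M\<close>, which \<open>p\<close> folds onto
    \<open>v\<close>. Only the edge between the twins collapses to \<open>{v}\<close>.\<close>
  define p where "p x = (if x = M then v else x)" for x
  define g where "g e = (if p ` e = {v} then c else f (p ` e))" for e
  let ?N = "neighbours f c {..<M} v"
  have p: "p x < M" if "x < Suc M" for x using that v by (auto simp: p_def)
  have pv: "p x = p y \<longleftrightarrow> x = y \<or> {x, y} = {v, M}" if "x < Suc M" "y < Suc M" for x y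
    using that v by (auto simp: p_def)
  have g_pair: "g {x, y} = (if {x, y} = {v, M} then c else f {p x, p y})"
    if "x < Suc M" "y < Suc M" "x \<noteq> y" for x y
    using that v by (auto simp: g_def p_def doubleton_eq_iff insert_commute)
  have f2: "f {x, y} < 2" if "x < M" "y < M" "x \<noteq> y" for x y
    using f that by (auto simp: avoids_def Pi_iff)
  have "g \<in> nsets {..<ramsey_number2 s} 2 \<rightarrow> {..<2}"
    unfolding R
  proof
    fix e assume "e \<in> nsets {..<Suc M} 2"
    then obtain x y where e: "e = {x, y}" and xy: "x < Suc M" "y < Suc M" "x \<noteq> y"
      by (auto elim: nsets2_E)
    have "g {x, y} < 2"
      using g_pair[OF xy] f2[OF p[OF xy(1)] p[OF xy(2)]] pv[OF xy(1,2)] xy(3) c by auto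
    then show "g e \<in> {..<2}" using e by simp
  qed
  then have "critical_multiplicity2 s \<le> card (mono_cliques (Suc M) s g)"
    using critical_multiplicity2_le R by metis
  also have "\<dots> \<le> card (cliques f c ?N (s - 2))"
  proof (rule card_inj_on_le)
    have key: "v \<in> H \<and> M \<in> H \<and> H - {v, M} \<in> cliques f c ?N (s - 2)"
      if H: "H \<in> mono_cliques (Suc M) s g" for H
    proof -
      obtain i where i: "i < 2" "unicolour g i H" and H': "H \<subseteq> {..<Suc M}" "finite H" "card H = s"
        using H unfolding mono_cliques_def image_nsets_2_subset_iff by (auto simp: nsets_def)
      \<comment> \<open>If a twin is missing, \<open>p\<close> is injective on \<open>H\<close> and
        maps it to a monochromatic \<open>s\<close>-clique of \<open>f\<close>.\<close>
      have mem: "v \<in> H \<and> M \<in> H"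
      proof (rule ccontr)
        assume no: "\<not> ?thesis"
        have inj: "inj_on p H"
          using no by (auto simp: inj_on_def p_def)
        have "f {p x, p y} = i" if "x \<in> H" "y \<in> H" "x \<noteq> y" for x y
        proof -
          have "{x, y} \<noteq> {v, M}" using that no by (auto simp: doubleton_eq_iff)
          then have "g {x, y} = f {p x, p y}"
            using g_pair[of x y] that H'(1) by auto
          moreover have "g {x, y} = i" using i(2) that by (simp add: unicolour_def)
          ultimately show ?thesis by simp
        qed
        then have "unicolour f i (p ` H)" by (auto simp: unicolour_def)
        then have "p ` H \<in> cliques f i {..<M} s"
          using H' inj p by (auto simp: cliques_def nsets_def card_image)
        then show False
          using f i(1) by (auto simp: avoids_def less_2_cases_iff)
      qed
      have "g {v, M} = i"
        using i(2) mem v by (simp add: unicolour_def)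
      then have ic: "i = c" using g_pair[of v M] v by simp
      \<comment> \<open>Here \<open>p\<close> fixes both \<open>x\<close> and \<open>y\<close>.
        Taking \<open>x = v\<close> puts the rest of \<open>H\<close> into the
        neighbourhood.\<close>
      have fg: "f {x, y} = c" if "x \<in> H" "y \<in> H - {v, M}" "x \<noteq> y" "x \<noteq> M" for x y
      proof -
        have "x < Suc M" "y < Suc M" using that H'(1) by auto
        then have "f {x, y} = g {x, y}"
          using g_pair[of x y] that by (auto simp: p_def doubleton_eq_iff)
        also have "\<dots> = c" using i(2) ic that by (simp add: unicolour_def)
        finally show ?thesis .
      qed
      have "H - {v, M} \<subseteq> ?N"
        using fg[of v] mem v H'(1) by (force simp: neighbours_def)
      moreover have "unicolour f c (H - {v, M})"
        using fg by (auto simp: unicolour_def)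
      moreover have "card (H - {v, M}) = s - 2"
        using mem v H' by (subst card_Diff_subset) auto
      ultimately show ?thesis
        using mem H'(2) by (simp add: cliques_def nsets_def)
    qed
    \<comment> \<open>Both twins lie in every \<open>H\<close>, so deleting them loses no
      information.\<close>
    show "inj_on (\<lambda>H. H - {v, M}) (mono_cliques (Suc M) s g)"
      using key by (intro inj_onI) blast
    show "(\<lambda>H. H - {v, M}) ` mono_cliques (Suc M) s g \<subseteq> cliques f c ?N (s - 2)"
      using key by blast
    show "finite (cliques f c ?N (s - 2))"
      by (intro finite_cliques) (simp add: neighbours_def)
  qed
  finally show ?thesis .
qed

theorem theorem3p4:
  fixes s :: nat
  assumes "s \<ge> 3"
  shows "int (critical_multiplicity2 s) \<le>
    Max {min (\<Prod>j=0..s-3. \<lceil>((real n1 - 2) - real j) / (real s - 2)\<rceil>)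
             (\<Prod>j=0..s-3. \<lceil>((real n2 - 2) - real j) / (real s - 2)\<rceil>) | n1 n2 :: nat.
           n1 \<ge> s \<and> n2 \<ge> s \<and>
           n1 + n2 \<le> ramsey_number2 s + 2 \<and>
           \<bar>int n1 - int n2\<bar> < int (ramsey_number (s - 1) s) - (int s - 2)}"
proof -
  define P where "P n = (\<Prod>j=0..s-3. \<lceil>((real n - 2) - real j) / (real s - 2)\<rceil>)" for n :: nat
  define Q where "Q n1 n2 \<longleftrightarrow> n1 \<ge> s \<and> n2 \<ge> s \<and> n1 + n2 \<le> ramsey_number2 s + 2 \<and>
    \<bar>int n1 - int n2\<bar> < int (ramsey_number (s - 1) s) - (int s - 2)" for n1 n2 :: nat
  have "ramsey_number (s - 1) s + s - 1 \<le> ramsey_number2 s"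
    using ramsey_number_Suc_ge[of "s - 1" s] assms by simp
  moreover have "ramsey_number (s - 1) s \<ge> 1"
    using assms by (intro ramsey_number_pos) auto
  moreover define M where "M = ramsey_number2 s - 1"
  ultimately have R: "ramsey_number2 s = Suc M" and M: "ramsey_number (s - 1) s + s \<le> M + 2"
    and "0 < M"
    using assms by auto
  obtain f where f: "avoids f {..<M} s s"
    using less_ramsey_number_avoids R by (metis lessI)
  define N where "N i = neighbours f i {..<M} 0" for i
  have less: "card (N i) < ramsey_number (s - 1) s" if "i < 2" for i
    unfolding N_def using f that \<open>0 < M\<close> assms by (intro card_neighbours_less) auto
  have add: "card (N 0) + card (N 1) = M - 1"
    using card_neighbours_add[OF f, of 0] \<open>0 < M\<close> by (simp add: N_def)
  \<comment> \<open>The sizes add up to \<open>M - 1 \<ge> R(s-1, s) + s - 3\<close> and each is at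
    most \<open>R(s-1, s) - 1\<close>, which leaves at least \<open>s - 2\<close> for the
    other.\<close>
  have ge: "card (N 0) \<ge> s - 2" "card (N 1) \<ge> s - 2"
    using less[of 0] less[of 1] add M by auto
  have Suc_s: "Suc (s - 2) = s - 1" using assms by simp
  have le: "int (critical_multiplicity2 s) \<le> P (card (N i) + 2)" if i: "i < 2" for i
  proof -
    have "cliques f i {..<M} (Suc (s - 1)) = {}"
      using f i assms by (auto simp: avoids_def less_2_cases_iff)
    then have "cliques f i (N i) (Suc (s - 2)) = {}"
      using neighbours_clique_free[of f i "{..<M}" "s - 1" 0] \<open>0 < M\<close> assms
      by (simp add: N_def Suc_s)
    moreover have "card (N i) \<ge> s - 2" using ge i by (auto simp: less_2_cases_iff)
    ultimately have "int (card (cliques f i (N i) (s - 2)))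
        \<le> (\<Prod>j<s - 2. \<lceil>(real (card (N i)) - real j) / real (s - 2)\<rceil>)"
      using assms by (intro card_cliques_le_prod_ceiling) (auto simp: N_def neighbours_def)
    also have "\<dots> = P (card (N i) + 2)"
      unfolding P_def using assms by (intro prod.cong) (auto simp: of_nat_diff)
    finally show ?thesis
      using critical_multiplicity2_le_cliques[OF f R \<open>0 < M\<close> i] by (simp add: N_def)
  qed
  let ?S = "{min (P n1) (P n2) | n1 n2. Q n1 n2}"
  have "?S \<subseteq> (\<lambda>(n1, n2). min (P n1) (P n2)) ` ({..ramsey_number2 s + 2} \<times> {..ramsey_number2 s + 2})"
    by (auto simp: Q_def)
  then have "finite ?S" by (rule finite_subset) simp
  \<comment> \<open>The sum is \<open>M + 3\<close>, which equals the allowed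
    \<open>R(s, s) + 2\<close>. Both sizes lie between \<open>s - 2\<close> and
    \<open>R(s-1, s) - 1\<close>, which bounds their difference.\<close>
  moreover have "Q (card (N 0) + 2) (card (N 1) + 2)"
    unfolding Q_def using less[of 0] less[of 1] add ge R assms \<open>0 < M\<close> by auto
  ultimately have "min (P (card (N 0) + 2)) (P (card (N 1) + 2)) \<le> Max ?S"
    by (intro Max_ge) blast+
  then have "int (critical_multiplicity2 s) \<le> Max ?S"
    using le[of 0] le[of 1] by simp
  then show ?thesis unfolding P_def Q_def .
qed

end
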